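(* Let $C_{w,f}$ be a weighted composition operator on $C_0(\Omega)$, and let $\mathfrak{X}$ be the closed subspace of $C_0(\Omega)$ generated by (i.e. the closed linear span of) the functions $\varphi \in C_0(\Omega)$ whose support is contained in a relatively compact open set $B$ in $\Omega$ satisfying \[ \liminf_{n \to \infty} \|w^{(n)}\|_{f^{-n}(B)} = 0. \] Then $C_{w,f}$ is Li-Yorke chaotic if and only if it is not power-bounded in $\mathfrak{X}$.
   Context: Fix $\mathbb{K} = \mathbb{R}$ or $\mathbb{C}$ and an arbitrary locally compact Hausdorff space $\Omega$. $C_0(\Omega)$ is the Banach space over $\mathbb{K}$ of all continuous maps $\varphi : \Omega \to \mathbb{K}$ vanishing at infinity, with norm $\|\varphi\| = \sup_{x\in\Omega} |\varphi(x)|$. For a bounded map $\varphi : \Omega \to \mathbb{K}$ and $B \subset \Omega$, $\|\varphi\|_B = \sup_{x\in B}|\varphi(x)|$, with $\|\varphi\|_\varnothing = 0$. The support of $\varphi$ is the closure of $\{x : \varphi(x) \ne 0\}$. A weighted composition operator on $C_0(\Omega)$ is the map $C_{w,f}(\varphi) = (\varphi\circ f)\cdot w$, where $w : \Omega \to \mathbb{K}$ is continuous and bounded, $f : \Omega \to \Omega$ is continuous, and the set $\{x \in \Omega : f(x) \in K \text{ and } |w(x)| \ge \varepsilon\}$ is compact for every $\varepsilon > 0$ and every compact $K \subset \Omega$; these conditions make $C_{w,f}$ a well-defined bounded linear operator on $C_0(\Omega)$. Put $w^{(1)} = w$ and $w^{(n)} = (w\circ f^{n-1})\cdots(w\circ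 f)\cdot w$ for $n \ge 2$; $\mathbb{N} = \{1,2,\ldots\}$. Given an operator $T$ on a Banach space $Y$ and a subspace $Z$ of $Y$, $T$ is power-bounded in $Z$ if there is $C \in (0,\infty)$ with $\|T^n|_Z\| \le C$ for all $n \in \mathbb{N}$, where $T^n|_Z : Z \to Y$ is the restriction of $T^n$ to $Z$. A map $g : M \to M$ on a metric space $(M,d)$ is Li-Yorke chaotic if there is an uncountable set $S \subset M$ such that for each pair $(x,y)$ of distinct points of $S$: $\liminf_{n\to\infty} d(g^n(x),g^n(y)) = 0$ and $\limsup_{n\to\infty} d(g^n(x),g^n(y)) > 0$. *)

theory Defs
  imports "HOL-Analysis.Analysis"
begin

text \<open>
  Scalar fields are handled by the type class of real normed fields, so that all notions below
  can be used at both \<^typ>\<open>real\<close> and \<^typ>\<open>complex\<close>. The library only provides real scalar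
  multiplication on bounded continuous functions; linear spans over the complex numbers
  need multiplication by scalars from the codomain.
\<close>

definition scaleK :: "'k::real_normed_field \<Rightarrow> ('a::topological_space \<Rightarrow>\<^sub>C 'k) \<Rightarrow> ('a \<Rightarrow>\<^sub>C 'k)"
  where "scaleK c \<phi> = Bcontfun (\<lambda>x. c * apply_bcontfun \<phi> x)"

lemma mult_bcontfun:
  fixes u v :: "'a::topological_space \<Rightarrow> 'k::real_normed_field"
  assumes "continuous_on UNIV u" "bounded (range u)" "continuous_on UNIV v" "bounded (range v)"
  shows "(\<lambda>x. u x * v x) \<in> bcontfun"
proof -
  obtain a where a: "\<And>x. norm (u x) \<le> a"
    using assms(2) unfolding bounded_iff by auto
  obtain b where b: "\<And>x. norm (v x) \<le> b"
    using assms(4) unfolding bounded_iff by auto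
  have "norm (u x * v x) \<le> a * b" for x
    unfolding norm_mult using a[of x] b[of x]
    by (intro mult_mono) (auto intro: order_trans[OF norm_ge_zero])
  then show ?thesis
    using assms by (intro bcontfun_normI continuous_intros) auto
qed

lemma scaleK_apply [simp]: "apply_bcontfun (scaleK c \<phi>) x = c * apply_bcontfun \<phi> x"
proof -
  have "(\<lambda>x. c * apply_bcontfun \<phi> x) \<in> bcontfun"
    by (rule mult_bcontfun) auto
  then show ?thesis
    by (simp add: scaleK_def Bcontfun_inverse)
qed

interpretation bcontfun_K: vector_space
  "scaleK :: 'k::real_normed_field \<Rightarrow> ('a::topological_space \<Rightarrow>\<^sub>C 'k) \<Rightarrow> ('a \<Rightarrow>\<^sub>C 'k)"
  by standard (auto intro!: bcontfun_eqI simp: algebra_simps)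

definition C0 :: "('a::topological_space \<Rightarrow>\<^sub>C 'k::real_normed_field) set"
  where "C0 = {\<phi>. \<forall>\<epsilon>>0. compact {x. \<epsilon> \<le> norm (apply_bcontfun \<phi> x)}}"

text \<open>The requirements on the weight and the self-map under which the weighted
  composition operator is a bounded operator on \<^const>\<open>C0\<close>.\<close>

definition wco_symbol :: "('a::topological_space \<Rightarrow> 'k::real_normed_field) \<Rightarrow> ('a \<Rightarrow> 'a) \<Rightarrow> bool"
  where "wco_symbol w f \<longleftrightarrow>
    continuous_on UNIV w \<and> bounded (range w) \<and> continuous_on UNIV f \<and>
    (\<forall>\<epsilon>>0. \<forall>K. compact K \<longrightarrow> compact {x. f x \<in> K \<and> \<epsilon> \<le> norm (w x)})"

text \<open>Only meaningful for \<^term>\<open>wco_symbol w f\<close>, when the function below is indeed bounded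
  and continuous.\<close>

definition wco :: "('a::topological_space \<Rightarrow> 'k::real_normed_field) \<Rightarrow> ('a \<Rightarrow> 'a)
    \<Rightarrow> ('a \<Rightarrow>\<^sub>C 'k) \<Rightarrow> ('a \<Rightarrow>\<^sub>C 'k)"
  where "wco w f \<phi> = Bcontfun (\<lambda>x. apply_bcontfun \<phi> (f x) * w x)"

definition iter_weight :: "('a \<Rightarrow> 'k::real_normed_field) \<Rightarrow> ('a \<Rightarrow> 'a) \<Rightarrow> nat \<Rightarrow> 'a \<Rightarrow> 'k"
  where "iter_weight w f n x = (\<Prod>k<n. w ((f ^^ k) x))"

definition sup_norm_on :: "'a set \<Rightarrow> ('a \<Rightarrow> 'k::real_normed_field) \<Rightarrow> real"
  where "sup_norm_on B \<phi> = (if B = {} then 0 else (SUP x\<in>B. norm (\<phi> x)))"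

definition supp :: "('a::topological_space \<Rightarrow> 'k::zero) \<Rightarrow> 'a set"
  where "supp \<phi> = closure {x. \<phi> x \<noteq> 0}"

text \<open>The closure is taken in the space of all bounded continuous functions; this is the same
  as the closure in \<^const>\<open>C0\<close>, which is a closed subset (lemma \<open>closed_C0\<close> below).\<close>

definition vanishing_space :: "('a::topological_space \<Rightarrow> 'k::real_normed_field) \<Rightarrow> ('a \<Rightarrow> 'a)
    \<Rightarrow> ('a \<Rightarrow>\<^sub>C 'k) set"
  where "vanishing_space w f = closure (bcontfun_K.span
    {\<phi> \<in> C0. \<exists>B. open B \<and> compact (closure B) \<and> supp (apply_bcontfun \<phi>) \<subseteq> B \<and>
       liminf (\<lambda>n. ereal (sup_norm_on ((f ^^ n) -` B) (iter_weight w f n))) = 0})"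

text \<open>The operator norm of the restriction of \<open>T\<close> to a subspace \<open>Z\<close>, with value infinity if
  the restriction is unbounded.\<close>

definition onorm_on :: "'b::real_normed_vector set \<Rightarrow> ('b \<Rightarrow> 'c::real_normed_vector) \<Rightarrow> ereal"
  where "onorm_on Z T = (SUP z\<in>{z \<in> Z. norm z \<le> 1}. ereal (norm (T z)))"

definition power_bounded_in :: "('b::real_normed_vector \<Rightarrow> 'b) \<Rightarrow> 'b set \<Rightarrow> bool"
  where "power_bounded_in T Z \<longleftrightarrow> (\<exists>C::real. C > 0 \<and> (\<forall>n\<ge>1. onorm_on Z (T ^^ n) \<le> ereal C))"

definition Li_Yorke_chaotic_on :: "'m::metric_space set \<Rightarrow> ('m \<Rightarrow> 'm) \<Rightarrow> bool"
  where "Li_Yorke_chaotic_on M g \<longleftrightarrow>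
    (\<exists>S\<subseteq>M. uncountable S \<and>
      (\<forall>x\<in>S. \<forall>y\<in>S. x \<noteq> y \<longrightarrow>
        liminf (\<lambda>n. ereal (dist ((g ^^ n) x) ((g ^^ n) y))) = 0 \<and>
        limsup (\<lambda>n. ereal (dist ((g ^^ n) x) ((g ^^ n) y))) > 0))"

lemma wco_apply:
  assumes "wco_symbol w f"
  shows "apply_bcontfun (wco w f \<phi>) x = apply_bcontfun \<phi> (f x) * w x"
proof -
  have "continuous_on UNIV (\<lambda>x. apply_bcontfun \<phi> (f x))"
    using assms continuous_on_compose2[OF continuous_on_apply_bcontfun[of UNIV \<phi>], of UNIV f]
    by (auto simp: wco_symbol_def)
  moreover have "bounded (range (\<lambda>x. apply_bcontfun \<phi> (f x)))"
    by (rule bounded_subset[OF bounded_apply_bcontfun[of \<phi>]]) auto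
  ultimately have "(\<lambda>x. apply_bcontfun \<phi> (f x) * w x) \<in> bcontfun"
    using assms by (intro mult_bcontfun) (auto simp: wco_symbol_def)
  then show ?thesis
    by (simp add: wco_def Bcontfun_inverse)
qed

lemma wco_C0:
  assumes "wco_symbol w f" "\<phi> \<in> C0"
  shows "wco w f \<phi> \<in> C0"
  unfolding C0_def
proof (intro CollectI allI impI)
  fix \<epsilon> :: real
  assume "\<epsilon> > 0"
  obtain b where b: "b > 0" "\<And>x. norm (w x) \<le> b"
    using assms(1) unfolding wco_symbol_def bounded_pos by auto
  define a where "a = norm \<phi> + 1"
  have a: "a > 0"
    unfolding a_def using norm_ge_zero[of \<phi>] by linarith
  have a': "norm (apply_bcontfun \<phi> x) \<le> a" for x
    unfolding a_def using norm_bounded[of \<phi> x] by linarith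
  let ?K = "{x. \<epsilon> / b \<le> norm (apply_bcontfun \<phi> x)}"
  let ?D = "{x. \<epsilon> \<le> norm (apply_bcontfun (wco w f \<phi>) x)}"
  have "compact ?K"
    using assms(2) \<open>\<epsilon> > 0\<close> b(1) by (simp add: C0_def)
  moreover have "\<epsilon> / a > 0"
    using \<open>\<epsilon> > 0\<close> a by simp
  ultimately have E: "compact {x. f x \<in> ?K \<and> \<epsilon> / a \<le> norm (w x)}"
    using assms(1) unfolding wco_symbol_def by blast
  have "closed ?D"
    by (intro closed_Collect_le continuous_intros) auto
  moreover have "?D \<subseteq> {x. f x \<in> ?K \<and> \<epsilon> / a \<le> norm (w x)}"
  proof
    fix x
    assume "x \<in> ?D"
    then have e: "\<epsilon> \<le> norm (apply_bcontfun \<phi> (f x)) * norm (w x)"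
      using assms(1) by (simp add: wco_apply norm_mult)
    have "\<epsilon> \<le> norm (apply_bcontfun \<phi> (f x)) * b"
      using e mult_left_mono[OF b(2)[of x] norm_ge_zero[of "apply_bcontfun \<phi> (f x)"]]
      by linarith
    moreover have "\<epsilon> \<le> a * norm (w x)"
      using e mult_right_mono[OF a'[of "f x"] norm_ge_zero[of "w x"]]
      by linarith
    ultimately show "x \<in> {x. f x \<in> ?K \<and> \<epsilon> / a \<le> norm (w x)}"
      using a b(1) by (simp add: pos_divide_le_eq mult.commute)
  qed
  ultimately show "compact ?D"
    using compact_Int_closed[OF E, of ?D] by (simp add: inf.absorb2)
qed

lemma closed_C0: "closed (C0 :: ('a::topological_space \<Rightarrow>\<^sub>C 'k::real_normed_field) set)"
proof -
  have "\<phi> \<in> C0" if \<phi>: "\<phi> \<in> closure C0" for \<phi> :: "'a \<Rightarrow>\<^sub>C 'k"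
    unfolding C0_def
  proof (intro CollectI allI impI)
    fix \<epsilon> :: real
    assume "\<epsilon> > 0"
    then have "\<epsilon> / 2 > 0"
      by simp
    then obtain \<psi> where \<psi>: "\<psi> \<in> C0" "dist \<psi> \<phi> < \<epsilon> / 2"
      using \<phi> unfolding closure_approachable by blast
    let ?D = "{x. \<epsilon> \<le> norm (apply_bcontfun \<phi> x)}"
    let ?E = "{x. \<epsilon> / 2 \<le> norm (apply_bcontfun \<psi> x)}"
    have E: "compact ?E"
      using \<psi>(1) \<open>\<epsilon> / 2 > 0\<close> unfolding C0_def by blast
    have "closed ?D"
      by (intro closed_Collect_le continuous_intros) auto
    moreover have "?D \<subseteq> ?E"
    proof
      fix x
      assume "x \<in> ?D"
      moreover have "dist (apply_bcontfun \<psi> x) (apply_bcontfun \<phi> x) < \<epsilon> / 2"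
        using \<psi>(2) by (rule dist_fun_lt_imp_dist_val_lt)
      moreover have "norm (apply_bcontfun \<phi> x) \<le>
          norm (apply_bcontfun \<psi> x) + dist (apply_bcontfun \<psi> x) (apply_bcontfun \<phi> x)"
        using norm_triangle_sub[of "apply_bcontfun \<phi> x" "apply_bcontfun \<psi> x"]
        by (simp add: dist_norm norm_minus_commute)
      ultimately show "x \<in> ?E"
        by simp
    qed
    ultimately show "compact ?D"
      using compact_Int_closed[OF E, of ?D] by (simp add: inf.absorb2)
  qed
  then have "closure C0 \<subseteq> (C0 :: ('a \<Rightarrow>\<^sub>C 'k) set)"
    by (rule subsetI)
  then show ?thesis
    by (simp only: closure_subset_eq)
qed

end

theory Submission
  imports Defs
begin

text \<open>
  Scalar multiples of a single vector \<open>\<phi>\<close> whose orbit satisfies \<open>lim inf \<parallel>T\<^sup>n \<phi>\<parallel> = 0\<close> and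
  \<open>lim sup \<parallel>T\<^sup>n \<phi>\<parallel> > 0\<close> form a scrambled set, so Li-Yorke chaos of \<open>T\<close> amounts to the existence
  of such a vector. Every \<open>\<phi>\<close> with \<open>lim inf \<parallel>T\<^sup>n \<phi>\<parallel> = 0\<close> lies in the space \<open>X\<close> of the theorem, by
  truncating \<open>\<phi>\<close> to the sets \<open>{|\<phi>| > \<delta>}\<close>; as all its iterates have the same property,
  power-boundedness in \<open>X\<close> would force \<open>T\<^sup>n \<phi> \<longrightarrow> 0\<close>. Conversely, the generators of \<open>X\<close> satisfy
  \<open>lim inf \<parallel>T\<^sup>n \<phi>\<parallel> = 0\<close>. If one of the orbits does not tend to zero, it is the orbit sought;
  otherwise all orbits starting in a dense subspace of \<open>X\<close> tend to zero, and if \<open>T\<close> is not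
  power-bounded in \<open>X\<close>, Baire's theorem yields an unbounded orbit that comes arbitrarily close
  to zero infinitely often.
\<close>

section \<open>Li-Yorke chaos for linear maps\<close>

lemma liminf_ereal_eq_0_iff:
  fixes u :: "nat \<Rightarrow> real"
  assumes "\<And>n. 0 \<le> u n"
  shows "liminf (\<lambda>n. ereal (u n)) = 0 \<longleftrightarrow> (\<forall>e>0. \<exists>\<^sub>F n in sequentially. u n < e)"
proof
  assume L: "liminf (\<lambda>n. ereal (u n)) = 0"
  show "\<forall>e>0. \<exists>\<^sub>F n in sequentially. u n < e"
  proof (intro allI impI notI)
    fix e :: real
    assume "e > 0"
    show "\<exists>\<^sub>F n in sequentially. u n < e"
    proof (rule ccontr)
      assume "\<not> (\<exists>\<^sub>F n in sequentially. u n < e)"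
      then have "\<forall>\<^sub>F n in sequentially. ereal e \<le> ereal (u n)"
        by (simp add: not_frequently not_less)
      then have "ereal e \<le> liminf (\<lambda>n. ereal (u n))"
        by (rule Liminf_bounded)
      with L \<open>e > 0\<close> show False
        by simp
    qed
  qed
next
  assume R: "\<forall>e>0. \<exists>\<^sub>F n in sequentially. u n < e"
  show "liminf (\<lambda>n. ereal (u n)) = 0"
  proof (rule ccontr)
    assume "liminf (\<lambda>n. ereal (u n)) \<noteq> 0"
    moreover have "0 \<le> liminf (\<lambda>n. ereal (u n))"
      using assms by (intro Liminf_bounded) auto
    ultimately have "0 < liminf (\<lambda>n. ereal (u n))"
      by simp
    then obtain e where e: "0 < ereal e" "ereal e < liminf (\<lambda>n. ereal (u n))"
      using ereal_dense2 by blast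
    have "\<forall>\<^sub>F n in sequentially. \<not> u n < e"
      using less_LiminfD[OF e(2)] by (auto elim: eventually_mono)
    then have "\<not> (\<exists>\<^sub>F n in sequentially. u n < e)"
      by (simp add: not_frequently)
    with R e(1) show False
      by simp
  qed
qed

lemma limsup_ereal_pos_iff:
  fixes u :: "nat \<Rightarrow> real"
  assumes "\<And>n. 0 \<le> u n"
  shows "limsup (\<lambda>n. ereal (u n)) > 0 \<longleftrightarrow> \<not> u \<longlonglongrightarrow> 0"
proof -
  have "u \<longlonglongrightarrow> 0 \<longleftrightarrow> (\<lambda>n. ereal (u n)) \<longlonglongrightarrow> ereal 0"
    by simp
  also have "\<dots> \<longleftrightarrow> liminf (\<lambda>n. ereal (u n)) = ereal 0 \<and> limsup (\<lambda>n. ereal (u n)) = ereal 0"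
    by (rule tendsto_iff_Liminf_eq_Limsup) simp
  also have "\<dots> \<longleftrightarrow> \<not> limsup (\<lambda>n. ereal (u n)) > 0"
  proof -
    have "0 \<le> liminf (\<lambda>n. ereal (u n))"
      using assms by (intro Liminf_bounded) auto
    moreover have "liminf (\<lambda>n. ereal (u n)) \<le> limsup (\<lambda>n. ereal (u n))"
      by (simp add: Liminf_le_Limsup)
    ultimately show ?thesis
      unfolding zero_ereal_def[symmetric] by (auto simp: not_less intro: antisym order_trans)
  qed
  finally show ?thesis
    by blast
qed

section \<open>Semi-irregular vectors and scrambled sets\<close>

text \<open>For linear \<open>T\<close> this says that \<open>x\<close> and 0 form a Li-Yorke
  pair.\<close>

definition semi_irregular :: "('b::real_normed_vector \<Rightarrow> 'b) \<Rightarrow> 'b \<Rightarrow> bool"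
  where "semi_irregular T x \<longleftrightarrow>
    (\<forall>e>0. \<exists>\<^sub>F n in sequentially. norm ((T ^^ n) x) < e) \<and> \<not> (\<lambda>n. (T ^^ n) x) \<longlonglongrightarrow> 0"

text \<open>By linearity the difference of two orbits is the orbit of the difference, so a condition
  on pairs becomes one on single vectors.\<close>

lemma semi_irregular_iff_dist:
  assumes T: "linear T"
  shows "semi_irregular T (x - y) \<longleftrightarrow>
     liminf (\<lambda>n. ereal (dist ((T ^^ n) x) ((T ^^ n) y))) = 0 \<and>
     limsup (\<lambda>n. ereal (dist ((T ^^ n) x) ((T ^^ n) y))) > 0"
proof -
  have "(T ^^ n) (x - y) = (T ^^ n) x - (T ^^ n) y" for n
    by (induction n) (simp_all add: linear_diff[OF T])
  then show ?thesis
    by (simp add: semi_irregular_def liminf_ereal_eq_0_iff limsup_ereal_pos_iff dist_norm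
        tendsto_norm_zero_iff)
qed

lemma semi_irregular_scaleR:
  assumes T: "linear T" and x: "semi_irregular T x" and c: "c \<noteq> 0"
  shows "semi_irregular T (c *\<^sub>R x)"
proof -
  have eq: "(T ^^ n) (c *\<^sub>R x) = c *\<^sub>R (T ^^ n) x" for n
    by (induction n) (simp_all add: linear_cmul[OF T])
  have "\<exists>\<^sub>F n in sequentially. norm (c *\<^sub>R (T ^^ n) x) < e" if "e > 0" for e
  proof -
    have "\<exists>\<^sub>F n in sequentially. norm ((T ^^ n) x) < e / \<bar>c\<bar>"
      using x that c by (simp add: semi_irregular_def)
    then show ?thesis
      by (rule frequently_elim1) (use c in \<open>simp add: field_simps\<close>)
  qed
  moreover have "\<not> (\<lambda>n. c *\<^sub>R (T ^^ n) x) \<longlonglongrightarrow> 0"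
  proof
    assume "(\<lambda>n. c *\<^sub>R (T ^^ n) x) \<longlonglongrightarrow> 0"
    then have "(\<lambda>n. inverse c *\<^sub>R (c *\<^sub>R (T ^^ n) x)) \<longlonglongrightarrow> inverse c *\<^sub>R 0"
      by (intro tendsto_intros)
    with c x show False
      by (simp add: semi_irregular_def)
  qed
  ultimately show ?thesis
    by (simp add: semi_irregular_def eq)
qed

text \<open>Two distinct points of a scrambled set have a semi-irregular difference. Conversely, a
  semi-irregular vector is nonzero, so its real multiples form an uncountable set, and differences
  of these are again multiples.\<close>

lemma Li_Yorke_chaotic_on_subspace_iff:
  assumes T: "linear T" and M: "subspace M"
  shows "Li_Yorke_chaotic_on M T \<longleftrightarrow> (\<exists>x\<in>M. semi_irregular T x)"
proof
  assume "Li_Yorke_chaotic_on M T"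
  then obtain S where S: "S \<subseteq> M" "uncountable S"
    and d: "\<And>x y. x \<in> S \<Longrightarrow> y \<in> S \<Longrightarrow> x \<noteq> y \<Longrightarrow> semi_irregular T (x - y)"
    unfolding Li_Yorke_chaotic_on_def semi_irregular_iff_dist[OF T] by blast
  obtain x where x: "x \<in> S"
    using S(2) by force
  have "uncountable (S - {x})"
    using S(2) by (simp add: uncountable_minus_countable)
  then obtain y where y: "y \<in> S - {x}"
    by (metis countable_empty ex_in_conv)
  show "\<exists>x\<in>M. semi_irregular T x"
    using d[of x y] x y S(1) subspace_diff[OF M, of x y] by blast
next
  assume "\<exists>x\<in>M. semi_irregular T x"
  then obtain x where x: "x \<in> M" "semi_irregular T x"
    by blast
  have "x \<noteq> 0"
  proof
    assume "x = 0"
    moreover have "(T ^^ n) 0 = 0" for n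
      by (induction n) (simp_all add: linear_0[OF T])
    ultimately show False
      using x(2) by (simp add: semi_irregular_def)
  qed
  then have "inj (\<lambda>c::real. c *\<^sub>R x)"
    by (auto intro: injI)
  then have "uncountable (range (\<lambda>c::real. c *\<^sub>R x))"
    using countable_image_inj_on uncountable_UNIV_real by blast
  moreover have "range (\<lambda>c::real. c *\<^sub>R x) \<subseteq> M"
    using x(1) M by (auto intro: subspace_scale)
  moreover have "semi_irregular T (a *\<^sub>R x - b *\<^sub>R x)" if "a *\<^sub>R x \<noteq> b *\<^sub>R x" for a b
    using semi_irregular_scaleR[OF T x(2), of "a - b"] that
    by (auto simp: scaleR_left_diff_distrib)
  ultimately show "Li_Yorke_chaotic_on M T"
    unfolding Li_Yorke_chaotic_on_def semi_irregular_iff_dist[OF T, symmetric] by blast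
qed

section \<open>Baire category in closed subspaces\<close>

lemma subspace_closure:
  fixes Y :: "'b::real_normed_vector set"
  assumes Y: "subspace Y"
  shows "subspace (closure Y)"
  unfolding subspace_def
proof (intro conjI ballI allI)
  show "0 \<in> closure Y"
    using subspace_0[OF Y] closure_subset by blast
next
  fix x y
  assume "x \<in> closure Y" "y \<in> closure Y"
  then obtain u v where "\<And>n. u n \<in> Y" "u \<longlonglongrightarrow> x" "\<And>n. v n \<in> Y" "v \<longlonglongrightarrow> y"
    unfolding closure_sequential by blast
  then show "x + y \<in> closure Y"
    unfolding closure_sequential
    by (intro exI[of _ "\<lambda>n. u n + v n"]) (auto intro: subspace_add[OF Y] tendsto_intros)
next
  fix c x
  assume "x \<in> closure Y"
  then obtain u where "\<And>n. u n \<in> Y" "u \<longlonglongrightarrow> x"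
    unfolding closure_sequential by blast
  then show "c *\<^sub>R x \<in> closure Y"
    unfolding closure_sequential
    by (intro exI[of _ "\<lambda>n. c *\<^sub>R u n"]) (auto intro: subspace_scale[OF Y] tendsto_intros)
qed

lemma completely_metrizable_space_closed_subset:
  fixes S :: "'b::metric_space set"
  assumes "complete (UNIV :: 'b set)" "closed S"
  shows "completely_metrizable_space (top_of_set S)"
proof -
  have "completely_metrizable_space (euclidean :: 'b topology)"
    using Met_TC.completely_metrizable_space_mtopology assms(1) by auto
  then show ?thesis
    using assms(2) by (intro completely_metrizable_space_closedin) auto
qed

lemma bounded_linear_funpow:
  fixes T :: "'b::real_normed_vector \<Rightarrow> 'b"
  assumes "bounded_linear T"
  shows "bounded_linear (T ^^ n)"
proof (induction n)
  case 0
  show ?case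
    using bounded_linear_ident by (simp add: id_def)
next
  case (Suc n)
  then show ?case
    using bounded_linear_compose[OF assms] by (simp add: o_def)
qed

text \<open>Both having large iterates and having frequently small iterates are generic (dense
  \<open>G\<^sub>\<delta>\<close>) properties in the closure of \<open>Y\<close>. Completeness is an assumption because the
  library has the corresponding class instance for bounded continuous functions only over
  metric domains.\<close>

lemma semi_irregular_of_not_power_bounded:
  fixes T :: "'b::real_normed_vector \<Rightarrow> 'b"
  assumes compl: "complete (UNIV :: 'b set)" and T: "bounded_linear T" and Y: "subspace Y"
    and lim: "\<And>y. y \<in> Y \<Longrightarrow> (\<lambda>n. (T ^^ n) y) \<longlonglongrightarrow> 0"
    and unb: "\<not> power_bounded_in T (closure Y)"
  shows "\<exists>x\<in>closure Y. semi_irregular T x"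
proof -
  let ?S = "closure Y"
  \<comment> \<open>One index \<open>k\<close> bounds both the time from below and the size from
    above, so a point of all \<open>U k\<close> has small iterates at arbitrarily late times. In
    \<open>V k\<close> the time is free: membership in all \<open>V k\<close> makes the orbit
    unbounded, which already excludes convergence.\<close>
  define U where "U k = ?S \<inter> (\<Union>n\<in>{k..}. {x. norm ((T ^^ n) x) < 1 / Suc k})" for k
  define V where "V k = ?S \<inter> (\<Union>n. {x. real k < norm ((T ^^ n) x)})" for k
  have S: "subspace ?S"
    by (rule subspace_closure[OF Y])
  have cont: "continuous_on UNIV (T ^^ n)" for n
    using bounded_linear_funpow[OF T] by (rule linear_continuous_on)
  have U_open: "openin (top_of_set ?S) (U k)" for k
    unfolding U_def
    by (intro openin_open_Int open_UN ballI open_Collect_less continuous_intros cont)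
  have V_open: "openin (top_of_set ?S) (V k)" for k
    unfolding V_def
    by (intro openin_open_Int open_UN ballI open_Collect_less continuous_intros cont)
  have U_dense: "?S \<subseteq> closure (U k)" for k
  proof -
    have "Y \<subseteq> U k"
    proof
      fix y
      assume y: "y \<in> Y"
      have "\<forall>\<^sub>F n in sequentially. norm ((T ^^ n) y) < 1 / Suc k"
        using tendstoD[OF lim[OF y], of "1 / Suc k"] by simp
      then have "\<forall>\<^sub>F n in sequentially. n \<ge> k \<and> norm ((T ^^ n) y) < 1 / Suc k"
        using eventually_ge_at_top by eventually_elim simp
      then obtain n where "n \<ge> k" "norm ((T ^^ n) y) < 1 / Suc k"
        by (auto simp: eventually_sequentially)
      with y closure_subset show "y \<in> U k"
        unfolding U_def by blast
    qed
    then show ?thesis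
      by (rule closure_mono)
  qed
  have big: "\<exists>n. \<exists>z\<in>?S. norm z \<le> 1 \<and> C < norm ((T ^^ n) z)" if "C > 0" for C
  proof -
    have "\<not> (\<forall>n\<ge>1. onorm_on ?S (T ^^ n) \<le> ereal C)"
      using unb that unfolding power_bounded_in_def by blast
    then obtain n where "\<not> onorm_on ?S (T ^^ n) \<le> ereal C"
      by blast
    then show ?thesis
      unfolding onorm_on_def SUP_le_iff by (auto simp: not_le)
  qed
  have V_dense: "?S \<subseteq> closure (V k)" for k
  proof
    fix x
    assume x: "x \<in> ?S"
    show "x \<in> closure (V k)"
      unfolding closure_approachable
    proof (intro allI impI)
      fix e :: real
      assume e: "e > 0"
      show "\<exists>y\<in>V k. dist y x < e"
      proof (cases "x \<in> V k")
        case True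
        then show ?thesis
          using e by force
      next
        case False
        \<comment> \<open>Moving \<open>x\<close> by \<open>(e / 2) *\<^sub>R z\<close> costs less
          than \<open>e\<close> and moves its image by more than \<open>2 * (k + 1)\<close>. The
          image of \<open>x\<close> has norm at most \<open>k\<close>, so the new image has norm
          above \<open>k\<close>.\<close>
        have "4 * (real k + 1) / e > 0"
          using e by simp
        from big[OF this] obtain n z where
          z: "z \<in> ?S" "norm z \<le> 1" "4 * (real k + 1) / e < norm ((T ^^ n) z)"
          by blast
        let ?y = "x + (e / 2) *\<^sub>R z"
        interpret bounded_linear "T ^^ n"
          by (rule bounded_linear_funpow[OF T])
        have "norm ((T ^^ n) x) \<le> k"
          using False x by (auto simp: V_def not_less)
        moreover have "2 * (real k + 1) < norm ((e / 2) *\<^sub>R (T ^^ n) z)"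
          using z(3) e by (simp add: field_simps)
        moreover have "norm ((e / 2) *\<^sub>R (T ^^ n) z) \<le> norm ((T ^^ n) ?y) + norm ((T ^^ n) x)"
          using norm_triangle_ineq4[of "(T ^^ n) ?y" "(T ^^ n) x"] by (simp add: add scaleR)
        ultimately have "2 * (real k + 1) < norm ((T ^^ n) ?y) + real k"
          by (meson add_left_mono less_le_trans order_trans)
        then have "real k < norm ((T ^^ n) ?y)"
          by simp
        moreover have "?y \<in> ?S"
          using x z(1) by (intro subspace_add[OF S] subspace_scale[OF S])
        ultimately have "?y \<in> V k"
          by (auto simp: V_def)
        moreover have "e * norm z \<le> e"
          using z(2) e by simp
        then have "dist ?y x < e"
          using e by (simp add: dist_norm)
        ultimately show ?thesis
          by blast
      qed
    qed
  qed
  have dense: "top_of_set ?S closure_of A = topspace (top_of_set ?S)"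
    if "A \<subseteq> ?S" "?S \<subseteq> closure A" for A
    using that by (simp add: closure_of_subtopology Int_absorb1 Int_absorb2)
  have "top_of_set ?S closure_of \<Inter>(range U \<union> range V) = topspace (top_of_set ?S)"
  proof (rule Baire_category)
    show "completely_metrizable_space (top_of_set ?S) \<or>
        locally_compact_space (top_of_set ?S) \<and> regular_space (top_of_set ?S)"
      using completely_metrizable_space_closed_subset[OF compl closed_closure] by blast
    show "countable (range U \<union> range V)"
      by simp
    fix A
    assume A: "A \<in> range U \<union> range V"
    then have "A \<subseteq> ?S"
      by (auto simp: U_def V_def)
    with A show "openin (top_of_set ?S) A \<and>
        top_of_set ?S closure_of A = topspace (top_of_set ?S)"
      using U_open V_open U_dense V_dense dense by auto
  qed
  moreover have "topspace (top_of_set ?S) \<noteq> {}"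
    using subspace_0[OF S] by auto
  ultimately have "\<Inter>(range U \<union> range V) \<noteq> {}"
    by (metis closure_of_empty)
  then obtain x where "x \<in> \<Inter>(range U \<union> range V)"
    by (meson ex_in_conv)
  then have xU: "x \<in> U k" and xV: "x \<in> V k" for k
    by simp_all
  have "\<exists>\<^sub>F n in sequentially. norm ((T ^^ n) x) < e" if e: "e > 0" for e
    unfolding frequently_sequentially
  proof
    fix N
    obtain m where m: "1 / Suc m < e"
      using nat_approx_posE[OF e] by blast
    define k where "k = max N m"
    obtain n where n: "n \<ge> k" "norm ((T ^^ n) x) < 1 / Suc k"
      using xU[of k] unfolding U_def by blast
    have "1 / Suc k \<le> 1 / Suc m"
      by (simp add: k_def field_simps)
    with n m show "\<exists>n\<ge>N. norm ((T ^^ n) x) < e"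
      by (intro exI[of _ n]) (auto simp: k_def)
  qed
  moreover have "\<not> (\<lambda>n. (T ^^ n) x) \<longlonglongrightarrow> 0"
  proof
    assume "(\<lambda>n. (T ^^ n) x) \<longlonglongrightarrow> 0"
    then have "Bseq (\<lambda>n. (T ^^ n) x)"
      by (intro convergent_imp_Bseq convergentI)
    then obtain K where K: "\<And>n. norm ((T ^^ n) x) \<le> K"
      unfolding Bseq_def by blast
    obtain k :: nat where "K < k"
      using reals_Archimedean2 by blast
    moreover obtain n where "k < norm ((T ^^ n) x)"
      using xV[of k] unfolding V_def by blast
    ultimately show False
      using K[of n] by linarith
  qed
  ultimately show ?thesis
    using xU[of 0] unfolding semi_irregular_def U_def by blast
qed

section \<open>Weighted composition operators\<close>

text \<open>A Cauchy sequence in the sup norm is uniformly Cauchy, hence converges uniformly, and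
  uniform limits of bounded continuous functions are bounded and continuous.\<close>

lemma complete_bcontfun:
  "complete (UNIV :: ('a::topological_space \<Rightarrow>\<^sub>C 'b::complete_space) set)"
  unfolding complete_def
proof (intro allI impI)
  fix s :: "nat \<Rightarrow> 'a \<Rightarrow>\<^sub>C 'b"
  assume "(\<forall>n. s n \<in> UNIV) \<and> Cauchy s"
  then obtain g where "uniform_limit UNIV s g sequentially"
    using uniformly_convergent_eq_cauchy[of "\<lambda>_. True" s]
    unfolding Cauchy_def uniform_limit_sequentially_iff
    by (metis dist_fun_lt_imp_dist_val_lt)
  from uniform_limit_bcontfunE[OF this sequentially_bot]
  obtain l where "s \<longlonglongrightarrow> l"
    by metis
  then show "\<exists>l\<in>UNIV. s \<longlonglongrightarrow> l"
    by blast
qed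

lemma scaleK_of_real: "scaleK (of_real r) \<phi> = r *\<^sub>R \<phi>"
  by (rule bcontfun_eqI) (simp add: scaleR_conv_of_real)

text \<open>Links the spans over the scalar field in \<open>vanishing_space\<close> with the general
  results above, which use real scalars.\<close>

lemma subspace_of_bcontfun_K_subspace:
  assumes "bcontfun_K.subspace M"
  shows "subspace M"
  using assms bcontfun_K.subspace_scale[OF assms, of _ "of_real _"]
  unfolding subspace_def bcontfun_K.subspace_def scaleK_of_real by blast

lemma compact_C0:
  assumes "\<phi> \<in> C0" "e > 0"
  shows "compact {x. e \<le> norm (apply_bcontfun \<phi> x)}"
  using assms unfolding C0_def by blast

lemma subspace_C0: "bcontfun_K.subspace (C0 :: ('a::topological_space \<Rightarrow>\<^sub>C 'k::real_normed_field) set)"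
  unfolding bcontfun_K.subspace_def
proof (intro conjI ballI allI)
  show "0 \<in> (C0 :: ('a \<Rightarrow>\<^sub>C 'k) set)"
    by (auto simp: C0_def not_le)
next
  fix \<phi> \<psi> :: "'a \<Rightarrow>\<^sub>C 'k"
  assume C: "\<phi> \<in> C0" "\<psi> \<in> C0"
  show "\<phi> + \<psi> \<in> C0"
    unfolding C0_def
  proof (intro CollectI allI impI)
    fix e :: real
    assume "e > 0"
    let ?D = "{x. e \<le> norm (apply_bcontfun (\<phi> + \<psi>) x)}"
    let ?E = "{x. e / 2 \<le> norm (apply_bcontfun \<phi> x)} \<union> {x. e / 2 \<le> norm (apply_bcontfun \<psi> x)}"
    have "compact ?E"
      using C \<open>e > 0\<close> by (intro compact_Un compact_C0) auto
    moreover have "closed ?D"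
      by (intro closed_Collect_le continuous_on_norm continuous_on_const
          continuous_on_apply_bcontfun)
    moreover have "?D \<subseteq> ?E"
    proof
      fix x
      assume "x \<in> ?D"
      then show "x \<in> ?E"
        using norm_triangle_ineq[of "apply_bcontfun \<phi> x" "apply_bcontfun \<psi> x"]
        by auto
    qed
    ultimately show "compact ?D"
      by (metis compact_Int_closed inf.absorb2)
  qed
next
  fix c :: 'k and \<phi> :: "'a \<Rightarrow>\<^sub>C 'k"
  assume C: "\<phi> \<in> C0"
  show "scaleK c \<phi> \<in> C0"
  proof (cases "c = 0")
    case True
    then show ?thesis
      by (auto simp: C0_def not_le)
  next
    case False
    have "{x. e \<le> norm (apply_bcontfun (scaleK c \<phi>) x)} = {x. e / norm c \<le> norm (apply_bcontfun \<phi> x)}"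
      for e
      using False by (simp add: norm_mult field_simps)
    then show ?thesis
      using C False by (simp add: C0_def)
  qed
qed

section \<open>Iterates of the operator and iterated weights\<close>

lemma wco_funpow_apply:
  assumes "wco_symbol w f"
  shows "apply_bcontfun ((wco w f ^^ n) \<phi>) x = apply_bcontfun \<phi> ((f ^^ n) x) * iter_weight w f n x"
proof (induction n arbitrary: x)
  case 0
  show ?case
    by (simp add: iter_weight_def)
next
  case (Suc n)
  \<comment> \<open>The factor split off is the one for \<open>k = 0\<close>, since the outermost
    application of the operator evaluates the inner iterate at \<open>f x\<close>.\<close>
  have "iter_weight w f (Suc n) x = w x * iter_weight w f n (f x)"
    unfolding iter_weight_def lessThan_Suc_eq_insert_0
    by (simp add: prod.reindex funpow_swap1)
  then show ?case
    using Suc by (simp add: wco_apply[OF assms] funpow_swap1[of f] mult_ac)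
qed

lemma norm_iter_weight_bounded:
  assumes "bounded (range w)"
  shows "\<exists>b. \<forall>x. norm (iter_weight w f n x) \<le> b"
proof -
  obtain b where b: "\<And>x. norm (w x) \<le> b"
    using assms unfolding bounded_iff by auto
  have "norm (iter_weight w f n x) \<le> b ^ n" for x
    unfolding iter_weight_def prod_norm[symmetric]
    using prod_mono[of "{..<n}" "\<lambda>k. norm (w ((f ^^ k) x))" "\<lambda>_. b"] b by simp
  then show ?thesis
    by blast
qed

text \<open>The bound on \<open>g\<close> makes the set bounded above, without which a real
  \<open>SUP\<close> carries no information.\<close>

lemma sup_norm_on_upper:
  assumes "\<And>x. norm (g x) \<le> b" "x \<in> A"
  shows "norm (g x) \<le> sup_norm_on A g"
proof -
  have "bdd_above ((\<lambda>x. norm (g x)) ` A)"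
    using assms(1) by (intro bdd_aboveI2)
  then have "norm (g x) \<le> (SUP x\<in>A. norm (g x))"
    using assms(2) by (rule cSUP_upper[rotated])
  then show ?thesis
    using assms(2) by (auto simp: sup_norm_on_def)
qed

text \<open>The condition \<open>0 \<le> b\<close> covers empty \<open>A\<close>, where the value is
  0 by convention.\<close>

lemma sup_norm_on_least:
  assumes "\<And>x. x \<in> A \<Longrightarrow> norm (g x) \<le> b" "0 \<le> b"
  shows "sup_norm_on A g \<le> b"
  using assms by (cases "A = {}") (simp_all add: sup_norm_on_def cSUP_least)

lemma sup_norm_on_nonneg:
  assumes "\<And>x. norm (g x) \<le> b"
  shows "0 \<le> sup_norm_on A g"
proof (cases "A = {}")
  case False
  then obtain x where "x \<in> A"
    by blast
  from sup_norm_on_upper[OF assms this] show ?thesis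
    by (rule order_trans[OF norm_ge_zero])
qed (simp add: sup_norm_on_def)

lemma bounded_linear_wco:
  fixes w :: "'a::topological_space \<Rightarrow> 'k::real_normed_field"
  assumes "wco_symbol w f"
  shows "bounded_linear (wco w f)"
proof -
  obtain b where b: "\<And>x. norm (w x) \<le> b"
    using assms unfolding wco_symbol_def bounded_iff by auto
  show ?thesis
  proof (rule bounded_linear_intro[where K = b])
    fix \<phi>
    show "norm (wco w f \<phi>) \<le> norm \<phi> * b"
      by (rule norm_bound)
        (auto simp: wco_apply[OF assms] norm_mult intro!: mult_mono norm_bounded b)
  qed (auto intro!: bcontfun_eqI simp: wco_apply[OF assms] algebra_simps)
qed

section \<open>Small orbits and small iterated weights\<close>

definition vanishing_along :: "('a \<Rightarrow> 'k::real_normed_field) \<Rightarrow> ('a \<Rightarrow> 'a) \<Rightarrow> 'a set \<Rightarrow> bool"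
  where "vanishing_along w f B \<longleftrightarrow>
    liminf (\<lambda>n. ereal (sup_norm_on ((f ^^ n) -` B) (iter_weight w f n))) = 0"

lemma vanishing_along_iff:
  assumes "wco_symbol w f"
  shows "vanishing_along w f B \<longleftrightarrow>
    (\<forall>e>0. \<exists>\<^sub>F n in sequentially. sup_norm_on ((f ^^ n) -` B) (iter_weight w f n) < e)"
  unfolding vanishing_along_def
proof (rule liminf_ereal_eq_0_iff)
  fix n
  obtain b where "\<And>x. norm (iter_weight w f n x) \<le> b"
    using norm_iter_weight_bounded[of w f n] assms unfolding wco_symbol_def by blast
  then show "0 \<le> sup_norm_on ((f ^^ n) -` B) (iter_weight w f n)"
    by (rule sup_norm_on_nonneg)
qed

text \<open>The \<open>n\<close>-th iterate vanishes at \<open>x\<close> unless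
  \<open>(f ^^ n) x\<close> lies in the support, hence in \<open>B\<close>; there the iterated
  weight is at most its sup norm over the preimage of \<open>B\<close>.\<close>

lemma wco_orbit_frequently_small:
  assumes ws: "wco_symbol w f" and supp: "supp (apply_bcontfun \<phi>) \<subseteq> B"
    and B: "vanishing_along w f B" and e: "e > 0"
  shows "\<exists>\<^sub>F n in sequentially. norm ((wco w f ^^ n) \<phi>) < e"
proof -
  \<comment> \<open>The summand 1 keeps the divisor positive when \<open>\<phi> = 0\<close>.\<close>
  have pos: "norm \<phi> + 1 > 0"
    using norm_ge_zero[of \<phi>] by linarith
  have "\<exists>\<^sub>F n in sequentially.
      sup_norm_on ((f ^^ n) -` B) (iter_weight w f n) < e / (norm \<phi> + 1)"
    using B e pos unfolding vanishing_along_iff[OF ws] by simp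
  then show ?thesis
  proof (rule frequently_elim1)
    fix n
    let ?s = "sup_norm_on ((f ^^ n) -` B) (iter_weight w f n)"
    assume s: "?s < e / (norm \<phi> + 1)"
    obtain b where b: "\<And>x. norm (iter_weight w f n x) \<le> b"
      using norm_iter_weight_bounded[of w f n] ws unfolding wco_symbol_def by blast
    have s0: "?s \<ge> 0"
      using b by (rule sup_norm_on_nonneg)
    have "norm (apply_bcontfun ((wco w f ^^ n) \<phi>) x) \<le> norm \<phi> * ?s" for x
    proof (cases "apply_bcontfun \<phi> ((f ^^ n) x) = 0")
      case True
      then show ?thesis
        using s0 by (simp add: wco_funpow_apply[OF ws])
    next
      case False
      then have "x \<in> (f ^^ n) -` B"
        using supp closure_subset[of "{x. apply_bcontfun \<phi> x \<noteq> 0}"] unfolding supp_def by auto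
      then have "norm (iter_weight w f n x) \<le> ?s"
        using b by (intro sup_norm_on_upper)
      then show ?thesis
        unfolding wco_funpow_apply[OF ws] norm_mult
        by (intro mult_mono norm_bounded) auto
    qed
    then have "norm ((wco w f ^^ n) \<phi>) \<le> norm \<phi> * ?s"
      by (rule norm_bound)
    also have "\<dots> \<le> (norm \<phi> + 1) * ?s"
      using s0 by (intro mult_right_mono) auto
    also have "\<dots> < e"
      using s pos by (simp add: field_simps)
    finally show "norm ((wco w f ^^ n) \<phi>) < e" .
  qed
qed

text \<open>Where \<open>\<phi>\<close> exceeds \<open>\<delta>\<close> at
  \<open>(f ^^ n) x\<close>, dividing by that value bounds the iterated weight at \<open>x\<close>
  by the norm of the \<open>n\<close>-th iterate over \<open>\<delta>\<close>.\<close>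

lemma vanishing_along_of_orbit_frequently_small:
  assumes ws: "wco_symbol w f" and \<delta>: "\<delta> > 0"
    and small: "\<forall>e>0. \<exists>\<^sub>F n in sequentially. norm ((wco w f ^^ n) \<phi>) < e"
  shows "vanishing_along w f {x. \<delta> < norm (apply_bcontfun \<phi> x)}"
  unfolding vanishing_along_iff[OF ws]
proof (intro allI impI)
  fix e :: real
  assume e: "e > 0"
  \<comment> \<open>Passing to a supremum loses strictness, so the pointwise bound aimed at is
    \<open>e / 2\<close>.\<close>
  have "\<exists>\<^sub>F n in sequentially. norm ((wco w f ^^ n) \<phi>) < e / 2 * \<delta>"
    using small e \<delta> half_gt_zero mult_pos_pos by blast
  then show "\<exists>\<^sub>F n in sequentially.
      sup_norm_on ((f ^^ n) -` {x. \<delta> < norm (apply_bcontfun \<phi> x)}) (iter_weight w f n) < e"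
  proof (rule frequently_elim1)
    fix n
    assume n: "norm ((wco w f ^^ n) \<phi>) < e / 2 * \<delta>"
    have "sup_norm_on ((f ^^ n) -` {x. \<delta> < norm (apply_bcontfun \<phi> x)}) (iter_weight w f n) \<le> e / 2"
    proof (rule sup_norm_on_least)
      fix x
      assume "x \<in> (f ^^ n) -` {x. \<delta> < norm (apply_bcontfun \<phi> x)}"
      then have "\<delta> * norm (iter_weight w f n x)
          \<le> norm (apply_bcontfun \<phi> ((f ^^ n) x)) * norm (iter_weight w f n x)"
        by (intro mult_right_mono) auto
      also have "\<dots> \<le> norm ((wco w f ^^ n) \<phi>)"
        using norm_bounded[of "(wco w f ^^ n) \<phi>" x]
        by (simp add: wco_funpow_apply[OF ws] norm_mult)
      also note n
      finally show "norm (iter_weight w f n x) \<le> e / 2"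
        using \<delta> by (simp add: mult.commute)
    qed (use e in simp)
    then show "sup_norm_on ((f ^^ n) -` {x. \<delta> < norm (apply_bcontfun \<phi> x)}) (iter_weight w f n) < e"
      using e by simp
  qed
qed

section \<open>Truncation and membership in \<open>vanishing_space\<close>\<close>

lemma truncation:
  fixes \<phi> :: "'a::topological_space \<Rightarrow>\<^sub>C 'k::real_normed_field"
  assumes \<phi>: "\<phi> \<in> C0" and e: "e > 0"
  shows "\<exists>\<psi>\<in>C0. dist \<psi> \<phi> \<le> e \<and> supp (apply_bcontfun \<psi>) \<subseteq> {x. e / 2 < norm (apply_bcontfun \<phi> x)}"
proof -
  \<comment> \<open>Soft thresholding: multiplying by \<open>h\<close> lowers the modulus by
    \<open>e\<close> where it is at least \<open>e\<close>, gives 0 elsewhere, and keeps the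
    argument. The \<open>max\<close> keeps the denominator positive and \<open>h\<close>
    continuous.\<close>
  define h where "h x = 1 - e / max e (norm (apply_bcontfun \<phi> x))" for x
  have h: "0 \<le> h x" "h x \<le> 1" for x
    using e by (auto simp: h_def field_simps)
  let ?p = "\<lambda>x. apply_bcontfun \<phi> x * of_real (h x)"
  define \<psi> where "\<psi> = Bcontfun ?p"
  have p_le: "norm (?p x) \<le> norm (apply_bcontfun \<phi> x)" for x
    using h[of x] by (simp add: norm_mult mult_left_le)
  have "continuous_on UNIV h"
    unfolding h_def using e by (intro continuous_intros) (auto simp: max_def)
  then have "continuous_on UNIV ?p"
    by (intro continuous_intros) auto
  then have "?p \<in> bcontfun"
    by (rule bcontfun_normI[where b = "norm \<phi>"]) (rule order_trans[OF p_le norm_bounded])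
  then have \<psi>: "apply_bcontfun \<psi> x = ?p x" for x
    by (simp add: \<psi>_def Bcontfun_inverse)
  have "\<psi> \<in> C0"
    unfolding C0_def
  proof (intro CollectI allI impI)
    fix d :: real
    assume "d > 0"
    then have "compact {x. d \<le> norm (apply_bcontfun \<phi> x)}"
      using \<phi> by (intro compact_C0)
    moreover have "closed {x. d \<le> norm (apply_bcontfun \<psi> x)}"
      by (intro closed_Collect_le continuous_intros) auto
    moreover have "{x. d \<le> norm (apply_bcontfun \<psi> x)} \<subseteq> {x. d \<le> norm (apply_bcontfun \<phi> x)}"
      using p_le \<psi> by (auto intro: order_trans)
    ultimately show "compact {x. d \<le> norm (apply_bcontfun \<psi> x)}"
      by (metis compact_Int_closed inf.absorb2)
  qed
  moreover have "dist \<psi> \<phi> \<le> e"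
  proof (rule dist_bound)
    fix x
    have "?p x - apply_bcontfun \<phi> x = - (apply_bcontfun \<phi> x * of_real (1 - h x))"
      by (simp add: algebra_simps)
    then have "dist (apply_bcontfun \<psi> x) (apply_bcontfun \<phi> x)
        = norm (apply_bcontfun \<phi> x) * (1 - h x)"
      using h[of x] unfolding \<psi> dist_norm by (simp add: norm_mult del: of_real_diff)
    also have "\<dots> = e * (norm (apply_bcontfun \<phi> x) / max e (norm (apply_bcontfun \<phi> x)))"
      by (simp add: h_def)
    also have "\<dots> \<le> e * 1"
      using e by (intro mult_left_mono) (auto simp: divide_le_eq_1)
    finally show "dist (apply_bcontfun \<psi> x) (apply_bcontfun \<phi> x) \<le> e"
      by simp
  qed
  \<comment> \<open>The support is a closure, so it is first placed in a closed level set; halving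
    the level then gives an open set around it.\<close>
  moreover have "supp (apply_bcontfun \<psi>) \<subseteq> {x. e \<le> norm (apply_bcontfun \<phi> x)}"
    unfolding supp_def
  proof (rule closure_minimal)
    show "{x. apply_bcontfun \<psi> x \<noteq> 0} \<subseteq> {x. e \<le> norm (apply_bcontfun \<phi> x)}"
      using e by (auto simp: \<psi> h_def max_def split: if_splits)
    show "closed {x. e \<le> norm (apply_bcontfun \<phi> x)}"
      by (intro closed_Collect_le continuous_intros) auto
  qed
  moreover have "{x. e \<le> norm (apply_bcontfun \<phi> x)} \<subseteq> {x. e / 2 < norm (apply_bcontfun \<phi> x)}"
    using e by auto
  ultimately show ?thesis
    by blast
qed

text \<open>Truncations of \<open>\<phi>\<close> are themselves generators: the superlevel set
  around their support is open, relatively compact since \<open>\<phi>\<close> is in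
  \<open>C0\<close>, and inherits the vanishing condition from the orbit of
  \<open>\<phi>\<close>.\<close>

lemma mem_vanishing_space:
  fixes w :: "'a::topological_space \<Rightarrow> 'k::real_normed_field"
  assumes ws: "wco_symbol w f" and \<phi>: "\<phi> \<in> C0"
    and small: "\<forall>e>0. \<exists>\<^sub>F n in sequentially. norm ((wco w f ^^ n) \<phi>) < e"
  shows "\<phi> \<in> vanishing_space w f"
  unfolding vanishing_space_def closure_approachable
proof (intro allI impI)
  fix e :: real
  assume e: "e > 0"
  \<comment> \<open>Truncating at \<open>e / 2\<close> gives distance strictly below
    \<open>e\<close>, and \<open>truncation\<close> halves that level for the surrounding open
    set.\<close>
  let ?B = "{x. e / 4 < norm (apply_bcontfun \<phi> x)}"
  obtain \<psi> where \<psi>: "\<psi> \<in> C0" "dist \<psi> \<phi> \<le> e / 2" "supp (apply_bcontfun \<psi>) \<subseteq> ?B"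
    using truncation[OF \<phi>, of "e / 2"] e by auto
  have "open ?B"
    by (intro open_Collect_less continuous_intros) auto
  moreover have "compact (closure ?B)"
  proof -
    let ?K = "{x. e / 4 \<le> norm (apply_bcontfun \<phi> x)}"
    have "compact ?K"
      using \<phi> e by (intro compact_C0) auto
    moreover have "closure ?B \<subseteq> ?K"
    proof (rule closure_minimal)
      show "closed ?K"
        by (intro closed_Collect_le continuous_intros) auto
    qed auto
    ultimately show ?thesis
      by (metis closed_closure compact_Int_closed inf.absorb2)
  qed
  moreover have "vanishing_along w f ?B"
    using e small by (intro vanishing_along_of_orbit_frequently_small[OF ws]) auto
  ultimately have "\<psi> \<in> bcontfun_K.span
      {\<phi> \<in> C0. \<exists>B. open B \<and> compact (closure B) \<and> supp (apply_bcontfun \<phi>) \<subseteq> B \<and>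
         liminf (\<lambda>n. ereal (sup_norm_on ((f ^^ n) -` B) (iter_weight w f n))) = 0}"
    using \<psi> unfolding vanishing_along_def by (intro bcontfun_K.span_base) blast
  moreover have "dist \<psi> \<phi> < e"
    using \<psi>(2) e by simp
  ultimately show "\<exists>y\<in>bcontfun_K.span
      {\<phi> \<in> C0. \<exists>B. open B \<and> compact (closure B) \<and> supp (apply_bcontfun \<phi>) \<subseteq> B \<and>
         liminf (\<lambda>n. ereal (sup_norm_on ((f ^^ n) -` B) (iter_weight w f n))) = 0}. dist y \<phi> < e"
    by blast
qed

section \<open>The equivalence over a complete normed field\<close>

lemma Li_Yorke_chaotic_wco_iff:
  fixes w :: "'a::topological_space \<Rightarrow> 'k::{real_normed_field,complete_space}"
  assumes ws: "wco_symbol w f"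
  shows "Li_Yorke_chaotic_on C0 (wco w f) \<longleftrightarrow> \<not> power_bounded_in (wco w f) (vanishing_space w f)"
proof -
  let ?T = "wco w f" and ?X = "vanishing_space w f"
  let ?G = "{\<phi> \<in> C0. \<exists>B. open B \<and> compact (closure B) \<and> supp (apply_bcontfun \<phi>) \<subseteq> B \<and>
       vanishing_along w f B}"
  have X: "?X = closure (bcontfun_K.span ?G)"
    by (simp add: vanishing_space_def vanishing_along_def)
  have bl: "bounded_linear ?T"
    by (rule bounded_linear_wco[OF ws])
  note lin = bounded_linear.linear[OF bl]
  have powC0: "(?T ^^ n) \<phi> \<in> C0" if "\<phi> \<in> C0" for n \<phi>
    by (induction n) (simp_all add: that wco_C0[OF ws])
  have "(\<exists>\<phi>\<in>C0. semi_irregular ?T \<phi>) \<longleftrightarrow> \<not> power_bounded_in ?T ?X"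
  proof (intro iffI notI)
    assume "\<exists>\<phi>\<in>C0. semi_irregular ?T \<phi>" and "power_bounded_in ?T ?X"
    then obtain \<phi> C where \<phi>: "\<phi> \<in> C0"
      and small: "\<forall>e>0. \<exists>\<^sub>F n in sequentially. norm ((?T ^^ n) \<phi>) < e"
      and nlim: "\<not> (\<lambda>n. (?T ^^ n) \<phi>) \<longlonglongrightarrow> 0"
      and C: "C > 0" "\<And>n. n \<ge> 1 \<Longrightarrow> onorm_on ?X (?T ^^ n) \<le> ereal C"
      unfolding semi_irregular_def power_bounded_in_def by blast
    \<comment> \<open>Once an iterate is small, the orbit stays small: the iterate divided by
      \<open>d\<close> lies in the unit ball of \<open>?X\<close>. A strict upper bound
      \<open>d\<close> replaces the norm itself, which may be 0.\<close>
    have bound: "norm ((?T ^^ n) ((?T ^^ m) \<phi>)) \<le> C * d"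
      if n: "n \<ge> 1" and d: "norm ((?T ^^ m) \<phi>) < d" for n m d
    proof -
      have d0: "d > 0"
        using d norm_ge_zero by (rule order.strict_trans1[rotated])
      define \<psi> where "\<psi> = (1 / d) *\<^sub>R (?T ^^ m) \<phi>"
      have pow: "(?T ^^ k) \<psi> = (1 / d) *\<^sub>R (?T ^^ (k + m)) \<phi>" for k
        using linear_cmul[OF bounded_linear.linear[OF bounded_linear_funpow[OF bl]]]
        by (simp add: \<psi>_def funpow_add)
      have "\<psi> \<in> C0"
        unfolding \<psi>_def
        by (intro subspace_scale[OF subspace_of_bcontfun_K_subspace[OF subspace_C0]] powC0 \<phi>)
      moreover have "\<forall>e>0. \<exists>\<^sub>F k in sequentially. norm ((?T ^^ k) \<psi>) < e"
        unfolding frequently_sequentially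
      proof (intro allI impI)
        fix e :: real and N
        assume "e > 0"
        then have "\<exists>\<^sub>F k in sequentially. norm ((?T ^^ k) \<phi>) < e * d"
          using small d0 by simp
        \<comment> \<open>The orbit of \<open>\<psi>\<close> is that of \<open>\<phi>\<close>
          shifted by \<open>m\<close> and divided by \<open>d\<close>; hence the offset
          \<open>m\<close> and the factor \<open>d\<close>.\<close>
        then obtain k where k: "k \<ge> N + m" "norm ((?T ^^ k) \<phi>) < e * d"
          unfolding frequently_sequentially by blast
        have "norm ((?T ^^ (k - m)) \<psi>) < e"
          using k d0 by (simp add: pow divide_less_eq)
        with k(1) show "\<exists>k\<ge>N. norm ((?T ^^ k) \<psi>) < e"
          by (intro exI[of _ "k - m"]) auto
      qed
      ultimately have "\<psi> \<in> ?X"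
        by (rule mem_vanishing_space[OF ws])
      moreover have "norm \<psi> \<le> 1"
        using d d0 by (simp add: \<psi>_def)
      ultimately have "ereal (norm ((?T ^^ n) \<psi>)) \<le> onorm_on ?X (?T ^^ n)"
        unfolding onorm_on_def by (intro SUP_upper) auto
      with C(2)[OF n] have "norm ((?T ^^ n) \<psi>) \<le> C"
        by (metis ereal_less_eq(3) order_trans)
      then show ?thesis
        using d0 by (simp add: pow funpow_add divide_le_eq)
    qed
    have "(\<lambda>n. (?T ^^ n) \<phi>) \<longlonglongrightarrow> 0"
    proof (rule LIMSEQ_I)
      fix r :: real
      assume "r > 0"
      then have "\<exists>\<^sub>F n in sequentially. norm ((?T ^^ n) \<phi>) < r / (2 * C)"
        using small C(1) by simp
      then obtain m where m: "norm ((?T ^^ m) \<phi>) < r / (2 * C)"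
        by (auto simp: frequently_sequentially)
      \<comment> \<open>Starting at \<open>Suc m\<close> makes \<open>n - m\<close> at least 1, as
        \<open>bound\<close> requires.\<close>
      have "norm ((?T ^^ n) \<phi>) < r" if "n \<ge> Suc m" for n
      proof -
        have "norm ((?T ^^ (n - m)) ((?T ^^ m) \<phi>)) \<le> C * (r / (2 * C))"
          using that by (intro bound m) auto
        moreover have "(?T ^^ (n - m)) ((?T ^^ m) \<phi>) = (?T ^^ n) \<phi>"
          using that funpow_add[of "n - m" m ?T] by simp
        ultimately show ?thesis
          using C(1) \<open>r > 0\<close> by simp
      qed
      then show "\<exists>no. \<forall>n\<ge>no. norm ((?T ^^ n) \<phi> - 0) < r"
        by auto
    qed
    with nlim show False
      by blast
  next
    assume unb: "\<not> power_bounded_in ?T ?X"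
    show "\<exists>\<phi>\<in>C0. semi_irregular ?T \<phi>"
    proof (cases "\<exists>\<phi>\<in>?G. \<not> (\<lambda>n. (?T ^^ n) \<phi>) \<longlonglongrightarrow> 0")
      case True
      then obtain \<phi> B where \<phi>: "\<phi> \<in> C0" "\<not> (\<lambda>n. (?T ^^ n) \<phi>) \<longlonglongrightarrow> 0"
        "supp (apply_bcontfun \<phi>) \<subseteq> B" "vanishing_along w f B"
        by blast
      then have "semi_irregular ?T \<phi>"
        unfolding semi_irregular_def using wco_orbit_frequently_small[OF ws] by blast
      with \<phi>(1) show ?thesis
        by blast
    next
      case False
      \<comment> \<open>Convergence of orbits to zero passes from the generators to their span
        because \<open>Z\<close> is a subspace over the full scalar field.\<close>
      define Z where "Z = {\<phi>. (\<lambda>n. (?T ^^ n) \<phi>) \<longlonglongrightarrow> 0}"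
      \<comment> \<open>\<open>bounded_linear\<close> gives only real homogeneity; scalars from the
        field are handled by the pointwise formula.\<close>
      have powK: "(?T ^^ n) (scaleK c \<phi>) = scaleK c ((?T ^^ n) \<phi>)" for n c \<phi>
        by (rule bcontfun_eqI) (simp add: wco_funpow_apply[OF ws])
      have "bcontfun_K.subspace Z"
        unfolding bcontfun_K.subspace_def
      proof (intro conjI ballI allI)
        show "0 \<in> Z"
          by (simp add: Z_def linear_0[OF bounded_linear.linear[OF bounded_linear_funpow[OF bl]]])
      next
        fix \<phi> \<psi>
        assume "\<phi> \<in> Z" "\<psi> \<in> Z"
        then show "\<phi> + \<psi> \<in> Z"
          by (auto simp: Z_def linear_add[OF bounded_linear.linear[OF bounded_linear_funpow[OF bl]]]
              intro: tendsto_add_zero)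
      next
        fix c :: 'k and \<phi>
        assume "\<phi> \<in> Z"
        then have "(\<lambda>n. norm c * norm ((?T ^^ n) \<phi>)) \<longlonglongrightarrow> 0"
          by (auto simp: Z_def intro!: tendsto_mult_right_zero tendsto_norm_zero)
        moreover have "norm (scaleK c \<psi>) \<le> norm c * norm \<psi>" for \<psi> :: "'a \<Rightarrow>\<^sub>C 'k"
          by (rule norm_bound) (auto simp: norm_mult intro: mult_left_mono norm_bounded)
        ultimately have "(\<lambda>n. scaleK c ((?T ^^ n) \<phi>)) \<longlonglongrightarrow> 0"
          by (intro Lim_null_comparison[of "\<lambda>n. scaleK c ((?T ^^ n) \<phi>)"]) (auto intro: always_eventually)
        then show "scaleK c \<phi> \<in> Z"
          by (simp add: Z_def powK)
      qed
      moreover have "?G \<subseteq> Z"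
        using False by (auto simp: Z_def)
      ultimately have "bcontfun_K.span ?G \<subseteq> Z"
        by (intro bcontfun_K.span_minimal)
      then have "\<exists>\<phi>\<in>?X. semi_irregular ?T \<phi>"
        unfolding X
        by (intro semi_irregular_of_not_power_bounded complete_bcontfun bl
            subspace_of_bcontfun_K_subspace bcontfun_K.subspace_span unb[unfolded X])
          (auto simp: Z_def)
      \<comment> \<open>The vector found by the category argument lies in \<open>?X\<close>;
        closedness of \<open>C0\<close> places it in \<open>C0\<close>.\<close>
      moreover have "bcontfun_K.span ?G \<subseteq> C0"
        by (intro bcontfun_K.span_minimal subspace_C0) auto
      then have "?X \<subseteq> C0"
        unfolding X by (rule closure_minimal[OF _ closed_C0])
      ultimately show ?thesis
        by blast
    qed
  qed
  then show ?thesis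
    by (simp add: Li_Yorke_chaotic_on_subspace_iff[OF lin
          subspace_of_bcontfun_K_subspace[OF subspace_C0]])
qed

theorem theorem18:
  assumes "locally_compact_space (euclidean :: 'a::t2_space topology)"
  shows "(\<forall>(w :: 'a \<Rightarrow> real) f. wco_symbol w f \<longrightarrow>
            (Li_Yorke_chaotic_on C0 (wco w f) \<longleftrightarrow>
             \<not> power_bounded_in (wco w f) (vanishing_space w f)))
       \<and> (\<forall>(w :: 'a \<Rightarrow> complex) f. wco_symbol w f \<longrightarrow>
            (Li_Yorke_chaotic_on C0 (wco w f) \<longleftrightarrow>
             \<not> power_bounded_in (wco w f) (vanishing_space w f)))"
  by (simp add: Li_Yorke_chaotic_wco_iff)

end
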